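(* The following series identity holds: $$\sum_{k=0}^{\infty}\left(\frac{-1}{27}\right)^k\frac{(1)_k^2}{(\frac{7}{6})_k(\frac{11}{6})_k}\left\{\frac{83+192k+112k^2}{64(1+4k)(3+4k)}H_{k}^{(2)}-\frac{10+39k+48k^2+16k^3}{(1+4k)^3(3+4k)^3(5+6k)^{-1}}\right\}=-\frac{15}{8}\beta(4).$$
   Context: For a complex number $x$ and a nonnegative integer $n$, the shifted factorial is $(x)_0=1$ and $(x)_n=x(x+1)\cdots(x+n-1)$ for $n\ge 1$; $(x)_n^m$ denotes $((x)_n)^m$. The harmonic numbers of order 2 are $H_n^{(2)}=\sum_{j=1}^n \frac{1}{j^2}$, with $H_0^{(2)}=0$. The constant $\beta(4)$ is $\beta(4)=\sum_{k=0}^{\infty}\frac{(-1)^k}{(1+2k)^4}$. The factor $(5+6k)^{-1}$ in the denominator is the reciprocal of $5+6k$, i.e. the fraction equals $\frac{(5+6k)(10+39k+48k^2+16k^3)}{(1+4k)^3(3+4k)^3}$. *)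

theory Defs
  imports "HOL-Analysis.Analysis"
begin

definition harm2 :: "nat \<Rightarrow> real" where
  "harm2 n = (\<Sum>j=1..n. 1 / real j ^ 2)"

definition beta4 :: real where
  "beta4 = (\<Sum>k. (-1) ^ k / (1 + 2 * real k) ^ 4)"

end

theory Submission
  imports Defs "HOL-Real_Asymp.Real_Asymp"
begin

text \<open>
  Put y = n + 2 k + 1/2. For a parameter x, the terms
  (-1)^(n+k) (1/2)_(n+k) (1-x)_k (1+x)_k / (3/2)_(n+3k) times y / (2 (y^2 - x^2))
  form the first half of a WZ pair. At k = 0 they are the terms (-1)^n / ((2n+1)^2 - 4 x^2),
  whose coefficient of x^2 sums to 4 beta(4); the companion at n = 0 gives the series with
  ratio -1/27. Since (1-x)_k (1+x)_k = k!^2 (1 - x^2 H_k + ...) with H_k the harmonic number of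
  order 2, the coefficients of x^2 on both sides of the WZ equation again form a WZ pair, and
  this is the one used.
\<close>

section \<open>The WZ pair\<close>

definition wz_weight :: "nat \<Rightarrow> nat \<Rightarrow> real" where
  "wz_weight n k = pochhammer (1/2) (n + k) * fact k ^ 2 / pochhammer (3/2) (n + 3 * k)"

text \<open>
  The WZ certificate has numerator \<open>cert_num0 + x^2 cert_num1 + O(x^4)\<close> over
  (y^2 - x^2) ((y+1)^2 - x^2); the functions \<open>cert0\<close> and \<open>cert1\<close> are the coefficients
  of x^0 and x^2 of the quotient. The numerators come from solving the telescoping
  equation for a polynomial of degree 5 in y.
\<close>

definition cert_num0 :: "real \<Rightarrow> real \<Rightarrow> real" where
  "cert_num0 k y = y^5 / 4 + (3/2 + 3*k/4) * y^4 + (15/4 + 4*k + k^2) * y^3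
     + (7/2 + 19*k/4 + 3*k^2/2) * y^2 + (k+1)*(k+2)/2 * y"

definition cert_num1 :: "real \<Rightarrow> real \<Rightarrow> real" where
  "cert_num1 k y = - (y^3/2 + (k+1)/2 * y^2 + (k^2 + 2*k + 1/4) * y + k*(3+2*k)/4)"

definition cert0 :: "real \<Rightarrow> real \<Rightarrow> real" where
  "cert0 k y = cert_num0 k y / (y^2 * (y+1)^2)"

definition cert1 :: "real \<Rightarrow> real \<Rightarrow> real" where
  "cert1 k y = cert_num1 k y / (y^2 * (y+1)^2)
     + cert_num0 k y / (y^2 * (y+1)^2) * (1 / y^2 + 1 / (y+1)^2)"

text \<open>The coefficient of x^2, read off from y / (2 (y^2 - x^2)) = 1/(2y) + x^2/(2y^3) + ...
  times the factor 1 - x^2 H_k + ....\<close>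

definition wz_F :: "nat \<Rightarrow> nat \<Rightarrow> real" where
  "wz_F n k = (-1) ^ (n + k) * wz_weight n k *
     (let y = real n + 2 * real k + 1/2 in 1 / (2 * y^3) - harm2 k / (2 * y))"

text \<open>Here v = n + 3k + 3/2, so v (v+1) extends the denominator (3/2)_(n+3k) of the weight to
  (3/2)_(n+3k+2). The numerator is again the coefficient of x^2, now of the certificate times 1 -
  x^2 H_k + ....\<close>

definition wz_G :: "nat \<Rightarrow> nat \<Rightarrow> real" where
  "wz_G n k = (-1) ^ (n + k) * wz_weight n k *
     (let y = real n + 2 * real k + 1/2; v = y + real k + 1
      in (cert1 k y - harm2 k * cert0 k y) / (v * (v + 1)))"

section \<open>Recurrences and bounds for the harmonic numbers and the weight\<close>

lemma harm2_Suc: "harm2 (Suc k) = harm2 k + 1 / (real k + 1)^2"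
  by (simp add: harm2_def add.commute)

lemma harm2_bounds: "0 \<le> harm2 k" "harm2 k \<le> real k"
proof -
  show "0 \<le> harm2 k" by (simp add: harm2_def sum_nonneg)
  have "harm2 k \<le> (\<Sum>j=1..k. 1)"
    unfolding harm2_def by (intro sum_mono) simp
  then show "harm2 k \<le> real k" by simp
qed

lemma wz_weight_Suc_left:
  "wz_weight (Suc n) k = wz_weight n k * (real n + real k + 1/2) / (real n + 3 * real k + 3/2)"
  by (simp add: wz_weight_def pochhammer_Suc field_simps)

lemma wz_weight_Suc_right:
  "wz_weight n (Suc k) = wz_weight n k * ((real k + 1)^2 * (real n + real k + 1/2) /
     ((real n + 3 * real k + 3/2) * (real n + 3 * real k + 5/2) * (real n + 3 * real k + 7/2)))"
proof -
  have "n + 3 * Suc k = Suc (Suc (Suc (n + 3 * k)))" by simp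
  then have "pochhammer (3/2 :: real) (n + 3 * Suc k) = pochhammer (3/2) (n + 3 * k) *
     ((real n + 3 * real k + 3/2) * (real n + 3 * real k + 5/2) * (real n + 3 * real k + 7/2))"
    by (simp only: pochhammer_Suc) (simp add: add_ac mult.assoc)
  then show ?thesis
    by (simp add: wz_weight_def pochhammer_Suc power_mult_distrib add_ac mult_ac)
qed

lemma wz_weight_pos: "0 < wz_weight n k"
  by (simp add: wz_weight_def pochhammer_pos)

lemma wz_weight_0_right: "wz_weight n 0 = 1 / (2 * real n + 1)"
proof (induction n)
  case 0
  show ?case by (simp add: wz_weight_def)
next
  case (Suc n)
  then show ?case by (simp add: wz_weight_Suc_left field_simps)
qed

text \<open>Induction on k from the exact value at k = 0. Any ratio below 1 that is uniform in n
  would do; 1/4 is easy to verify.\<close>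

lemma wz_weight_le: "wz_weight n k \<le> 1 / (2 * real n + 1) * (1/4) ^ k"
proof (induction k)
  case 0
  show ?case by (simp add: wz_weight_0_right)
next
  case (Suc k)
  define K N where "K = real k" and "N = real n"
  have nonneg: "K \<ge> 0" "N \<ge> 0" by (simp_all add: K_def N_def)
  \<comment> \<open>Splitting 4 (K+1)^2 into two factors 2(K+1) allows a factor-by-factor comparison
    with the denominator.\<close>
  have "4 * ((K + 1)^2 * (N + K + 1/2)) = (N + K + 1/2) * (2 * (K+1)) * (2 * (K+1))"
    by (simp add: power2_eq_square algebra_simps)
  also have "\<dots> \<le> (N + 3*K + 3/2) * (N + 3*K + 5/2) * (N + 3*K + 7/2)"
    by (intro mult_mono) (use nonneg in auto)
  finally have ratio: "(K + 1)^2 * (N + K + 1/2) /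
      ((N + 3*K + 3/2) * (N + 3*K + 5/2) * (N + 3*K + 7/2)) \<le> 1/4"
    using nonneg by (simp add: divide_le_eq)
  have "wz_weight n (Suc k) \<le> wz_weight n k * (1/4)"
    unfolding wz_weight_Suc_right using ratio wz_weight_pos[of n k]
    by (intro mult_left_mono) (simp_all add: K_def N_def)
  also have "\<dots> \<le> 1 / (2 * real n + 1) * (1/4) ^ k * (1/4)"
    using Suc.IH by (intro mult_right_mono) simp_all
  finally show ?case by simp
qed

section \<open>Verification of the WZ equation\<close>

lemma cert_num0_identity:
  "cert_num0 k y * (y+k+3) * (y+2)^2 + (y-k) * cert_num0 k (y+1) * y^2
    = (y * ((y+k+1) * (y+k+2) * (y+k+3)) * (y+1)^2 * (y+2)^2
       + (y-k) * (y+2) * (y^2 * (y+1)^2 * (k+1)^2)) / 2"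
  by (simp add: cert_num0_def field_simps power_numeral_reduce)

text \<open>The coefficient of x^2 in the polynomial equation whose coefficient of x^0 is
  \<open>cert_num0_identity\<close>. In that equation each of y^2, (y+1)^2, (y+2)^2 and (k+1)^2 is
  diminished by x^2; the last one is (k+1-x)(k+1+x), the new factor of (1-x)_k (1+x)_k.\<close>

lemma cert_num1_identity:
  "cert_num1 k y * (y+k+3) * (y+2)^2 + (y-k) * cert_num1 k (y+1) * y^2
     - cert_num0 k y * (y+k+3) - (y-k) * cert_num0 k (y+1)
    = - (y * ((y+k+1) * (y+k+2) * (y+k+3)) * ((y+1)^2 + (y+2)^2)
         + (y-k) * (y+2) * (y^2 * (y+1)^2 + (y+1)^2 * (k+1)^2 + y^2 * (k+1)^2)) / 2"
  by (simp add: cert_num0_def cert_num1_def field_simps power_numeral_reduce)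

text \<open>The x^0 part of the WZ equation after division by (-1)^(n+k) and the weight. Raising n
  shifts y by 1, raising k shifts y by 2, and the alternating sign turns both differences into
  sums.\<close>

lemma cert0_identity:
  fixes k y :: real
  assumes "k \<ge> 0" "y > 0"
  defines "v \<equiv> y + k + 1"
  shows "1 / (2*y) + (k+1)^2 * (y-k) / (v * (v+1) * (v+2)) * (1 / (2*(y+2)))
    = cert0 k y / (v * (v+1)) + (y-k)/v * (cert0 k (y+1) / ((v+1) * (v+2)))"
proof -
  define a b c d where "a = y^2" and "b = (y+1)^2" and "c = (y+2)^2" and "d = (k+1)^2"
  define v1 v2 where "v1 = v + 1" and "v2 = v + 2"
  define P Q where "P = cert_num0 k y" and "Q = cert_num0 k (y+1)"
  have pos: "a \<noteq> 0" "b \<noteq> 0" "c \<noteq> 0" "v \<noteq> 0" "v1 \<noteq> 0" "v2 \<noteq> 0" "y \<noteq> 0" "y + 2 \<noteq> 0"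
    using assms by (auto simp: a_def b_def c_def v1_def v2_def v_def)
  have "P * v2 * c + (y-k) * Q * a = (y * (v * v1 * v2) * b * c + (y-k) * (y+2) * (a * b * d)) / 2"
    using cert_num0_identity[of k y]
    by (simp add: P_def Q_def a_def b_def c_def d_def v1_def v2_def v_def add_ac mult_ac)
  then have "(P * v2 * c + (y-k) * Q * a) / (a * b * c * (v * v1 * v2))
    = ((y * (v * v1 * v2) * b * c + (y-k) * (y+2) * (a * b * d)) / 2) / (a * b * c * (v * v1 * v2))"
    by (simp only:)
  also have "\<dots> = y / (2 * a) + d * (y-k) / (v * v1 * v2) * ((y+2) / (2 * c))"
    using pos by (simp add: field_simps)
  also have "y / (2 * a) = 1 / (2 * y)"
    using pos by (simp add: a_def power2_eq_square)
  also have "(y+2) / (2 * c) = 1 / (2 * (y+2))"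
    using pos by (simp add: c_def power2_eq_square)
  also have "(P * v2 * c + (y-k) * Q * a) / (a * b * c * (v * v1 * v2))
    = P / (a * b) / (v * v1) + (y-k)/v * (Q / (b * c) / (v1 * v2))"
    using pos by (simp add: add_divide_distrib mult_ac)
  finally show ?thesis
    by (simp add: cert0_def P_def Q_def a_def b_def c_def d_def v1_def v2_def add_ac)
qed

lemma cert1_identity:
  fixes k y :: real
  assumes "k \<ge> 0" "y > 0"
  defines "v \<equiv> y + k + 1"
  shows "1 / (2*y^3) + (k+1)^2 * (y-k) / (v * (v+1) * (v+2)) *
      (1 / (2*(y+2)^3) - 1 / (k+1)^2 / (2*(y+2)))
    = cert1 k y / (v * (v+1)) + (y-k)/v * (cert1 k (y+1) / ((v+1) * (v+2)))"
proof -
  define a b c d where "a = y^2" and "b = (y+1)^2" and "c = (y+2)^2" and "d = (k+1)^2"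
  define v1 v2 where "v1 = v + 1" and "v2 = v + 2"
  define P Q where "P = cert_num0 k y" and "Q = cert_num0 k (y+1)"
  define P1 Q1 where "P1 = cert_num1 k y" and "Q1 = cert_num1 k (y+1)"
  \<comment> \<open>With t = x^2, 1 / ((a-t)(b-t)(c-t)) = (1 + s t + ...) / (a b c). So the x^2 part
    of the quotient is the x^2 identity plus s times the x^0 identity, over D.\<close>
  define D s where "D = a * b * c * (v * v1 * v2)" and "s = 1/a + 1/b + 1/c"
  have pos: "a \<noteq> 0" "b \<noteq> 0" "c \<noteq> 0" "d \<noteq> 0" "v \<noteq> 0" "v1 \<noteq> 0" "v2 \<noteq> 0" "y \<noteq> 0" "y + 2 \<noteq> 0"
    using assms by (auto simp: a_def b_def c_def d_def v1_def v2_def v_def)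
  have E0: "P * v2 * c + (y-k) * Q * a = (y * (v * v1 * v2) * b * c + (y-k) * (y+2) * (a * b * d)) / 2"
    using cert_num0_identity[of k y]
    by (simp add: P_def Q_def a_def b_def c_def d_def v1_def v2_def v_def add_ac mult_ac)
  have E1: "P1 * v2 * c + (y-k) * Q1 * a - P * v2 - (y-k) * Q
      = - (y * (v * v1 * v2) * (b + c) + (y-k) * (y+2) * (a * b + b * d + a * d)) / 2"
    using cert_num1_identity[of k y]
    by (simp add: P_def Q_def P1_def Q1_def a_def b_def c_def d_def v1_def v2_def v_def add_ac)
  have "(P1 / (a * b) + P / (a * b) * (1/a + 1/b)) / (v * v1)
      + (y-k)/v * ((Q1 / (b * c) + Q / (b * c) * (1/b + 1/c)) / (v1 * v2))
    = ((P1 * v2 * c + (y-k) * Q1 * a - P * v2 - (y-k) * Q)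
        + s * (P * v2 * c + (y-k) * Q * a)) / D"
    using pos by (simp add: D_def s_def field_simps)
  also have "\<dots> = y / (2 * a^2) + d * (y-k) / (v * v1 * v2) * ((y+2) / (2 * c^2) - (y+2) / (2 * c * d))"
    unfolding E0 E1 using pos by (simp add: D_def s_def field_simps power2_eq_square)
  also have "y / (2 * a^2) = 1 / (2 * y^3)"
    using pos by (simp add: a_def power_numeral_reduce)
  also have "(y+2) / (2 * c^2) = 1 / (2 * (y+2)^3)"
    using pos by (simp add: c_def power_numeral_reduce)
  also have "(y+2) / (2 * c * d) = 1 / d / (2 * (y+2))"
    using pos by (simp add: c_def power_numeral_reduce)
  finally show ?thesis
    by (simp add: cert1_def P_def Q_def P1_def Q1_def a_def b_def c_def d_def v1_def v2_def add_ac)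
qed

lemma wz_identity: "wz_F n k - wz_F n (Suc k) = wz_G n k - wz_G (Suc n) k"
proof -
  define K y h where "K = real k" and "y = real n + 2 * real k + 1/2" and "h = harm2 k"
  define v where "v = y + K + 1"
  define S where "S = (-1) ^ (n + k) * wz_weight n k"
  \<comment> \<open>The ratio of the weights at k+1 and k: y - K = n + k + 1/2 and v = n + 3k +
    3/2.\<close>
  define r where "r = (K+1)^2 * (y-K) / (v * (v+1) * (v+2))"
  have K: "K \<ge> 0" and y: "y > 0" by (auto simp: K_def y_def)
  have "wz_F n k = S * (1 / (2*y^3) - h / (2*y))"
    by (simp add: wz_F_def S_def y_def h_def)
  moreover have "wz_weight n (Suc k) = wz_weight n k * r"
    unfolding wz_weight_Suc_right r_def v_def y_def K_def by (simp add: algebra_simps)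
  then have "wz_F n (Suc k) = - S * r * (1 / (2*(y+2)^3) - (h + 1 / (K+1)^2) / (2*(y+2)))"
    by (simp add: wz_F_def S_def y_def h_def K_def harm2_Suc algebra_simps)
  moreover have "wz_G n k = S * ((cert1 K y - h * cert0 K y) / (v * (v+1)))"
    by (simp add: wz_G_def S_def y_def h_def K_def v_def Let_def)
  moreover have "wz_weight (Suc n) k = wz_weight n k * ((y-K)/v)"
    unfolding wz_weight_Suc_left v_def y_def K_def by (simp add: algebra_simps)
  then have "wz_G (Suc n) k
      = - S * ((y-K)/v) * ((cert1 K (y+1) - h * cert0 K (y+1)) / ((v+1) * (v+2)))"
    by (simp add: wz_G_def S_def y_def h_def K_def v_def Let_def add_ac)
  moreover have "(1 / (2*y^3) - h / (2*y)) + r * (1 / (2*(y+2)^3) - (h + 1 / (K+1)^2) / (2*(y+2)))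
      = (cert1 K y - h * cert0 K y) / (v * (v+1))
        + (y-K)/v * ((cert1 K (y+1) - h * cert0 K (y+1)) / ((v+1) * (v+2)))"
  proof -
    \<comment> \<open>Both sides are affine in h. The coefficient of h is settled by
      \<open>cert0_identity\<close>; the rest, including the increment 1/(K+1)^2 of the harmonic
      number, by \<open>cert1_identity\<close>.\<close>
    have "(1 / (2*y^3) - h / (2*y)) + r * (1 / (2*(y+2)^3) - (h + 1 / (K+1)^2) / (2*(y+2)))
      = (1 / (2*y^3) + r * (1 / (2*(y+2)^3) - 1 / (K+1)^2 / (2*(y+2))))
        - h * (1 / (2*y) + r * (1 / (2*(y+2))))"
      by (simp add: algebra_simps add_divide_distrib diff_divide_distrib)
    also have "\<dots> = (cert1 K y / (v * (v+1)) + (y-K)/v * (cert1 K (y+1) / ((v+1) * (v+2))))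
        - h * (cert0 K y / (v * (v+1)) + (y-K)/v * (cert0 K (y+1) / ((v+1) * (v+2))))"
      using cert0_identity[OF K y] cert1_identity[OF K y] by (simp add: r_def v_def)
    also have "\<dots> = (cert1 K y - h * cert0 K y) / (v * (v+1))
        + (y-K)/v * ((cert1 K (y+1) - h * cert0 K (y+1)) / ((v+1) * (v+2)))"
      by (simp add: algebra_simps add_divide_distrib diff_divide_distrib)
    finally show ?thesis .
  qed
  ultimately show ?thesis
    by (simp only: mult_minus_left diff_minus_eq_add mult.assoc flip: distrib_left)
qed

section \<open>Limits, summability and telescoping\<close>

lemma wz_G_tendsto_0: "(\<lambda>n. wz_G n k) \<longlonglongrightarrow> 0"
proof (rule Lim_null_comparison)
  define K h where "K = real k" and "h = harm2 k"
  define g where "g = (\<lambda>n. let y = real n + 2 * K + 1/2; v = y + K + 1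
      in (cert1 K y - h * cert0 K y) / (v * (v + 1)))"
  show "\<forall>\<^sub>F n in sequentially. norm (wz_G n k) \<le> \<bar>g n\<bar>"
  proof (intro always_eventually allI)
    fix n
    have "wz_weight n k \<le> 1 / (2 * real n + 1) * (1/4) ^ k" by (rule wz_weight_le)
    also have "\<dots> \<le> 1 * 1"
      by (intro mult_mono) (auto simp: power_le_one)
    finally have "\<bar>wz_weight n k\<bar> \<le> 1" using wz_weight_pos[of n k] by simp
    then have "\<bar>wz_weight n k\<bar> * \<bar>g n\<bar> \<le> 1 * \<bar>g n\<bar>" by (intro mult_right_mono) auto
    then show "norm (wz_G n k) \<le> \<bar>g n\<bar>"
      by (simp add: wz_G_def g_def K_def h_def abs_mult Let_def)
  qed
  \<comment> \<open>\<open>cert0\<close> and \<open>cert1\<close> grow at most linearly in y, while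
    v (v+1) is quadratic; hence bounding the weight by 1 is enough.\<close>
  have "g \<longlonglongrightarrow> 0"
    unfolding g_def Let_def cert1_def cert0_def cert_num0_def cert_num1_def by real_asymp
  then show "(\<lambda>n. \<bar>g n\<bar>) \<longlonglongrightarrow> 0" by (rule tendsto_rabs_zero)
qed

text \<open>Separating n from k gives summability over n and, uniformly, decay in k. One factor
  1/(2n+1) comes from the weight, the other from 1/(2y); the 4 comes from y \<ge> 1/2, and k from
  H_k \<le> k.\<close>

lemma wz_F_bound: "\<bar>wz_F n k\<bar> \<le> (4 + real k) * (1/4) ^ k * (1 / (2 * real n + 1)^2)"
proof -
  define y where "y = real n + 2 * real k + 1/2"
  have y: "y \<ge> real n + 1/2" "y > 0" "y \<ge> 1/2" by (auto simp: y_def)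
  have inv: "1 / (2*y) \<le> 1 / (2 * real n + 1)"
    using y by (intro divide_left_mono) auto
  have "(1/2)^2 \<le> y^2" using y by (intro power_mono) auto
  then have inv2: "1 / y^2 \<le> 4" using y by (simp add: divide_le_eq power2_eq_square)
  have "\<bar>1 / (2*y^3) - harm2 k / (2*y)\<bar> = 1 / (2*y) * \<bar>1 / y^2 - harm2 k\<bar>"
    using y by (simp add: abs_mult power_def flip: abs_mult_pos) (simp add: field_simps power_numeral_reduce)
  also have "\<dots> \<le> 1 / (2 * real n + 1) * (4 + real k)"
  proof (intro mult_mono inv)
    have "0 \<le> 1 / y^2" by simp
    then show "\<bar>1 / y^2 - harm2 k\<bar> \<le> 4 + real k" using inv2 harm2_bounds[of k] by linarith
  qed auto
  finally have "wz_weight n k * \<bar>1 / (2*y^3) - harm2 k / (2*y)\<bar>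
      \<le> (1 / (2 * real n + 1) * (1/4) ^ k) * (1 / (2 * real n + 1) * (4 + real k))"
    using wz_weight_le wz_weight_pos[of n k] by (intro mult_mono) auto
  then show ?thesis
    using wz_weight_pos[of n k] by (simp add: wz_F_def abs_mult y_def power2_eq_square mult_ac)
qed

lemma summable_inverse_odd_squares: "summable (\<lambda>n. 1 / (2 * real n + 1)^2)"
proof (rule summable_comparison_test')
  show "summable (\<lambda>n. 1 / real (Suc n) ^ 2)"
    using inverse_squares_sums by (simp add: sums_iff add.commute)
  fix n :: nat
  show "norm (1 / (2 * real n + 1)^2) \<le> 1 / real (Suc n) ^ 2"
    by (auto intro!: divide_left_mono power_mono)
qed

lemma summable_wz_F: "summable (\<lambda>n. wz_F n k)"
  by (rule summable_comparison_test'[OF summable_mult[OF summable_inverse_odd_squares]])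
     (use wz_F_bound in auto)

lemma suminf_wz_F_tendsto_0: "(\<lambda>k. \<Sum>n. wz_F n k) \<longlonglongrightarrow> 0"
proof (rule Lim_null_comparison)
  define C where "C = (\<Sum>n. 1 / (2 * real n + 1)^2)"
  show "\<forall>\<^sub>F k in sequentially. norm (\<Sum>n. wz_F n k) \<le> (4 + real k) * (1/4) ^ k * C"
  proof (intro always_eventually allI)
    fix k
    have "norm (\<Sum>n. wz_F n k) \<le> (\<Sum>n. (4 + real k) * (1/4) ^ k * (1 / (2 * real n + 1)^2))"
      by (rule norm_suminf_le[OF _ summable_mult[OF summable_inverse_odd_squares]])
         (use wz_F_bound in simp)
    then show "norm (\<Sum>n. wz_F n k) \<le> (4 + real k) * (1/4) ^ k * C"
      by (simp only: C_def suminf_mult[OF summable_inverse_odd_squares])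
  qed
  show "(\<lambda>k. (4 + real k) * (1/4) ^ k * C) \<longlonglongrightarrow> 0"
    by real_asymp
qed

lemma wz_G_sums: "(\<lambda>k. wz_G 0 k) sums (\<Sum>n. wz_F n 0)"
proof -
  \<comment> \<open>Summing the WZ equation over n collapses its right side to the boundary term at
    n = 0; the resulting differences then telescope in k.\<close>
  have "(\<Sum>n. wz_F n k) - (\<Sum>n. wz_F n (Suc k)) = wz_G 0 k" for k
  proof -
    have "(\<lambda>n. wz_G n k - wz_G (Suc n) k) sums (wz_G 0 k - 0)"
      by (rule telescope_sums'[OF wz_G_tendsto_0])
    then have "(\<lambda>n. wz_F n k - wz_F n (Suc k)) sums wz_G 0 k"
      by (simp add: wz_identity)
    then show ?thesis
      using suminf_diff[OF summable_wz_F summable_wz_F] by (simp add: sums_iff)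
  qed
  then show ?thesis
    using telescope_sums'[OF suminf_wz_F_tendsto_0] by simp
qed

section \<open>Evaluation of the two boundary series\<close>

lemma suminf_wz_F_0: "(\<Sum>n. wz_F n 0) = 4 * beta4"
proof -
  \<comment> \<open>At k = 0 the harmonic term vanishes and the weight 1/(2n+1) supplies the fourth
    power.\<close>
  have F: "wz_F n 0 = 4 * ((-1) ^ n / (1 + 2 * real n) ^ 4)" for n
  proof -
    have "1 / (2 * (real n + 1/2)^3) = 4 / (2 * real n + 1)^3"
      by (simp add: divide_simps) (simp add: power3_eq_cube algebra_simps)
    then show ?thesis
      by (simp add: wz_F_def wz_weight_0_right harm2_def power_numeral_reduce add.commute)
  qed
  \<comment> \<open>Pulling 4 out of the infinite sum needs convergence of the series for
    \<open>beta4\<close>, which is inherited from \<open>wz_F\<close>.\<close>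
  then have "summable (\<lambda>n. 4 * ((-1) ^ n / (1 + 2 * real n) ^ 4))"
    using summable_wz_F[of 0] by simp
  then have "summable (\<lambda>n. (-1) ^ n / (1 + 2 * real n) ^ 4 :: real)"
    by (subst (asm) summable_cmult_iff) simp
  then show ?thesis
    unfolding F beta4_def by (rule suminf_mult)
qed

text \<open>The source is triplication: (3/2)_(3k) = 27^k (1/2)_k (5/6)_k (7/6)_k. Here (1/2)_k
  cancels, and (5/6)_k = (11/6)_k * 5 / (5+6k) accounts for the last factor.\<close>

lemma wz_weight_0_left:
  "wz_weight 0 k = (1/27) ^ k * (pochhammer 1 k ^ 2 / (pochhammer (7/6) k * pochhammer (11/6) k))
     * ((5 + 6 * real k) / 5)"
proof (induction k)
  case 0
  show ?case by (simp add: wz_weight_def)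
next
  case (Suc k)
  have ratio: "(K + 1)^2 * (K + 1/2) / ((3*K + 3/2) * (3*K + 5/2) * (3*K + 7/2))
      = 1/27 * ((K + 1)^2 / ((7/6 + K) * (11/6 + K))) * ((11 + 6*K) / (5 + 6*K))"
    if "K \<ge> 0" for K :: real
    using that by (simp add: divide_simps) algebra
  show ?case
    unfolding wz_weight_Suc_right Suc.IH using ratio[of "real k"]
    by (simp add: pochhammer_Suc power_mult_distrib add_ac mult_ac)
qed

text \<open>The factor -15/32 is fixed by the normalization of the target series: it takes 4
  \<open>beta4\<close> to -(15/8) \<open>beta4\<close>.\<close>

lemma wz_G_0_left:
  "- (15/32) * wz_G 0 k = (-1 / 27) ^ k
     * (pochhammer 1 k ^ 2 / (pochhammer (7 / 6) k * pochhammer (11 / 6) k))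
     * ((83 + 192 * real k + 112 * real k ^ 2)
          / (64 * (1 + 4 * real k) * (3 + 4 * real k)) * harm2 k
        - (10 + 39 * real k + 48 * real k ^ 2 + 16 * real k ^ 3)
          / ((1 + 4 * real k) ^ 3 * (3 + 4 * real k) ^ 3 * inverse (5 + 6 * real k)))"
proof -
  define K where "K = real k"
  define y where "y = 2 * K + 1/2"
  have pos: "5 + 6 * K \<noteq> 0" "1 + 4 * K \<noteq> 0" "3 + 4 * K \<noteq> 0" "9 + 6 * K \<noteq> 0" "1 + 2 * K \<noteq> 0"
    by (auto simp: K_def)
  have y: "y = (1 + 4*K) / 2" "y + 1 = (3 + 4*K) / 2" "y + K + 1 = 3 * (1 + 2*K) / 2"
     "y + K + 1 + 1 = (5 + 6*K) / 2"
    by (simp_all add: y_def field_simps)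
  \<comment> \<open>The factor 5+6K from the weight cancels v+1 = (5+6K)/2. The factor 1+2K of v
    cancels against the certificate numerator at n = 0.\<close>
  have c0: "(5 + 6*K) / 5 * (15/32) * (cert0 K y / ((y + K + 1) * (y + K + 1 + 1)))
      = (83 + 192*K + 112*K^2) / (64 * (1 + 4*K) * (3 + 4*K))"
    unfolding cert0_def y cert_num0_def using pos by (simp add: divide_simps) algebra
  have c1: "(5 + 6*K) / 5 * (15/32) * (cert1 K y / ((y + K + 1) * (y + K + 1 + 1)))
      = (10 + 39*K + 48*K^2 + 16*K^3) / ((1 + 4*K)^3 * (3 + 4*K)^3 * inverse (5 + 6*K))"
    unfolding cert1_def y cert_num0_def cert_num1_def using pos by (simp add: divide_simps) algebra
  define Z where "Z = (y + K + 1) * (y + K + 1 + 1)"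
  have "wz_G 0 k = (-1) ^ k * wz_weight 0 k * ((cert1 K y - harm2 k * cert0 K y) / Z)"
    by (simp add: wz_G_def K_def y_def Z_def Let_def)
  moreover have "(-1 / 27 :: real) ^ k = (-1) ^ k * (1/27) ^ k"
    by (simp flip: power_mult_distrib)
  moreover have "- (15/32) * (e * (q * R * (T/5)) * ((C1 - h * C0) / Z))
      = (e * q) * R * (T / 5 * (15/32) * (C0 / Z) * h - T / 5 * (15/32) * (C1 / Z))"
    for e q R T C0 C1 h :: real
    by (simp add: diff_divide_distrib right_diff_distrib mult_ac)
  ultimately have "- (15/32) * wz_G 0 k = (-1 / 27) ^ k
      * (pochhammer 1 k ^ 2 / (pochhammer (7 / 6) k * pochhammer (11 / 6) k))
      * ((5 + 6*K) / 5 * (15/32) * (cert0 K y / Z) * harm2 k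
         - (5 + 6*K) / 5 * (15/32) * (cert1 K y / Z))"
    by (simp only: wz_weight_0_left K_def)
  then show ?thesis
    unfolding Z_def c0 c1 by (simp add: K_def)
qed

theorem theorem1p6:
  shows "(\<lambda>k::nat.
            (-1 / 27 :: real) ^ k
            * (pochhammer 1 k ^ 2 / (pochhammer (7 / 6) k * pochhammer (11 / 6) k))
            * ((83 + 192 * real k + 112 * real k ^ 2)
                 / (64 * (1 + 4 * real k) * (3 + 4 * real k)) * harm2 k
               - (10 + 39 * real k + 48 * real k ^ 2 + 16 * real k ^ 3)
                 / ((1 + 4 * real k) ^ 3 * (3 + 4 * real k) ^ 3 * inverse (5 + 6 * real k))))
         sums (- (15 / 8) * beta4)"
  using sums_mult[OF wz_G_sums, of "- (15/32)"] unfolding wz_G_0_left suminf_wz_F_0 by simp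

end
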